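(* Let $H_1,H_2$ be Hilbert spaces, let $C\subset H_1$ and $Q\subset H_2$ be closed convex subsets, and let $A:H_1\to H_2$ be a bounded linear operator. Assume that the split feasibility problem $$\text{find } x^*\in C \text{ such that } Ax^*\in Q$$ is consistent (i.e. has at least one solution). Let $\delta$ be the spectral radius of $A^*A$, let $\gamma\in(0,2/\delta)$, and assume that $$T=P_C\left(I-\gamma A^*(I-P_Q)A\right):H_1\to H_1$$ is a $(k,a)$-enriched Kannan mapping for some $k\in[0,\infty)$ and $a\in[0,1/2)$. Then the split feasibility problem has a unique solution $x^*$, and there exists $\lambda\in[0,1)$ such that, for any $x_0\in C$, the sequence $\{x_n\}$ defined by $$x_{n+1}=(1-\lambda)x_n+\lambda P_C\left(I-\gamma A^*(I-P_Q)A\right)x_n,\quad n\ge 0,$$ converges strongly (in norm) to $x^*$.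
   Context: $P_C$ and $P_Q$ denote the nearest point projections onto $C$ and $Q$, respectively, $I$ is the identity map, and $A^*$ is the adjoint of $A$. For a normed linear space $(X,\|\cdot\|)$, a mapping $T:X\to X$ is called a $(k,a)$-enriched Kannan mapping, where $k\in[0,\infty)$ and $a\in[0,1/2)$, if $$\|k(x-y)+Tx-Ty\|\le a\left[\|x-Tx\|+\|y-Ty\|\right]\quad\text{for all }x,y\in X.$$ *)

theory Defs
  imports "HOL-Analysis.Analysis"
begin

definition sfp_solutions :: "'a set \<Rightarrow> 'b set \<Rightarrow> ('a \<Rightarrow> 'b) \<Rightarrow> 'a set" where
  "sfp_solutions C Q A = {x \<in> C. A x \<in> Q}"

(* The library's closest_point requires the class heine_borel, hence finite dimension. *)
definition nearest_point :: "'a::metric_space set \<Rightarrow> 'a \<Rightarrow> 'a" where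
  "nearest_point C x = arg_min_on (dist x) C"

(* T - z I acting on the complexification of the real space 'a, where the pair (x, y)
   stands for x + i y. *)
definition complexified_shift ::
  "('a::real_normed_vector \<Rightarrow> 'a) \<Rightarrow> complex \<Rightarrow> 'a \<times> 'a \<Rightarrow> 'a \<times> 'a" where
  "complexified_shift T z =
     (\<lambda>(x, y). (T x - (Re z *\<^sub>R x - Im z *\<^sub>R y), T y - (Im z *\<^sub>R x + Re z *\<^sub>R y)))"

(* A real-linear two-sided inverse of the complex-linear map T - z I is automatically
   complex linear, so it suffices to ask for bounded_linear. *)
definition spectrum :: "('a::real_normed_vector \<Rightarrow> 'a) \<Rightarrow> complex set" where
  "spectrum T = {z. \<not> (\<exists>S. bounded_linear S \<and>
     S \<circ> complexified_shift T z = id \<and> complexified_shift T z \<circ> S = id)}"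

(* With values in ennreal, the radius is 0 on the zero space (empty spectrum), and
   2 / 0 is infinite, so that for the zero operator the interval (0, 2 / radius) is
   (0, infinity). *)
definition spectral_radius :: "('a::real_normed_vector \<Rightarrow> 'a) \<Rightarrow> ennreal" where
  "spectral_radius T = (SUP z\<in>spectrum T. ennreal (cmod z))"

definition enriched_kannan ::
  "real \<Rightarrow> real \<Rightarrow> ('a::real_normed_vector \<Rightarrow> 'a) \<Rightarrow> bool" where
  "enriched_kannan k a T \<longleftrightarrow> 0 \<le> k \<and> 0 \<le> a \<and> a < 1 / 2 \<and>
     (\<forall>x y. norm (k *\<^sub>R (x - y) + T x - T y) \<le> a * (norm (x - T x) + norm (y - T y)))"

(* adjoint picks some map satisfying the adjoint identity; for a bounded linear A on a
   Hilbert space this map exists and is unique. *)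
definition sfp_operator ::
  "'a::real_inner set \<Rightarrow> 'b::real_inner set \<Rightarrow> ('a \<Rightarrow> 'b) \<Rightarrow> real \<Rightarrow> 'a \<Rightarrow> 'a" where
  "sfp_operator C Q A \<gamma> x =
     nearest_point C (x - \<gamma> *\<^sub>R adjoint A (A x - nearest_point Q (A x)))"

end

theory Submission
  imports Defs
begin

text \<open>A solution \<open>z\<close> of the split feasibility problem is a fixed point of
  \<open>T = P\<^sub>C (I - \<gamma> A\<^sup>* (I - P\<^sub>Q) A)\<close>: the residual \<open>A z - P\<^sub>Q (A z)\<close> vanishes, and \<open>P\<^sub>C\<close> fixes the
  points of \<open>C\<close>. Consistency therefore hands over a fixed point \<open>p\<close> of \<open>T\<close>, and everything else
  follows from comparing an arbitrary point \<open>x\<close> with \<open>p\<close> in the enriched Kannan inequality.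

  Put \<open>u = x - p\<close> and \<open>w = T x - p\<close>. The inequality for the pair \<open>x, p\<close> reads
  \<open>\<parallel>k u + w\<parallel> \<le> a \<parallel>u - w\<parallel>\<close>, and writing \<open>u - w = (k + 1) u - (k u + w)\<close> turns it into
  \<open>\<parallel>k u + w\<parallel> \<le> (k + 1) c \<parallel>u\<parallel>\<close> with \<open>c = a / (1 - a) < 1\<close>
  (\<open>enriched_kannan_bound_at_fixed_point\<close>). A second fixed point would have \<open>w = u\<close>, hence
  \<open>u = 0\<close>, so the solution is unique. The usual averaging weight is \<open>1 / (k + 1)\<close>, which makes the
  averaged map satisfy \<open>\<parallel>T' x - p\<parallel> \<le> c \<parallel>x - p\<parallel>\<close>; it equals 1 when \<open>k = 0\<close>. The smaller weight
  \<open>1 / (k + 2)\<close> mixes in some more of the identity, still shrinks the distance to \<open>p\<close> by a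
  constant factor below 1, and is less than 1 for every \<open>k \<ge> 0\<close>.

  That \<open>A\<^sup>*\<close> sends 0 to 0 depends on the adjoint really existing, since \<open>adjoint A\<close> is a choice
  among the maps with the adjoint identity. In a Hilbert space of arbitrary dimension this is the
  Riesz representation theorem, which is proved by minimising \<open>\<parallel>x\<parallel>\<^sup>2 - 2 g x\<close>.\<close>

text \<open>The quadratic functional \<open>F x = \<parallel>x\<parallel>\<^sup>2 - 2 g x\<close> is bounded below, and the parallelogram law
  makes each of its minimising sequences Cauchy. At the minimiser \<open>v\<close> the derivative
  \<open>2 (v \<bullet> h - g h)\<close> in every direction \<open>h\<close> vanishes.\<close>

lemma riesz_representation:
  fixes g :: "'a::{real_inner, complete_space} \<Rightarrow> real"
  assumes "bounded_linear g"
  shows "\<exists>v. \<forall>x. g x = x \<bullet> v"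
proof -
  interpret g: bounded_linear g by fact
  define F where "F x = x \<bullet> x - 2 * g x" for x
  define m where "m = (INF x. F x)"
  obtain K where K: "\<And>x. norm (g x) \<le> norm x * K"
    using g.bounded by blast
  have "- (K\<^sup>2) \<le> F x" for x
  proof -
    have "g x \<le> norm x * K" using K[of x] by simp
    moreover have "0 \<le> (norm x - K)\<^sup>2" by simp
    ultimately show ?thesis
      unfolding F_def dot_square_norm by (simp add: power2_eq_square algebra_simps)
  qed
  then have bdd: "bdd_below (range F)" by (intro bdd_belowI[of _ "- (K\<^sup>2)"]) auto
  have m_le: "m \<le> F x" for x
    unfolding m_def by (rule cINF_lower[OF bdd]) simp
  have midpoint: "F ((1/2) *\<^sub>R (x + y)) = (F x + F y) / 2 - (norm (x - y))\<^sup>2 / 4" for x y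
    unfolding F_def dot_square_norm[symmetric]
    by (simp add: g.add g.scale inner_commute field_simps inner_add_left inner_add_right
        inner_diff_left inner_diff_right)
  have gap: "(norm (x - y))\<^sup>2 \<le> 2 * (F x - m) + 2 * (F y - m)" for x y
    using m_le[of "(1/2) *\<^sub>R (x + y)"] midpoint[of x y] by (simp add: field_simps)
  have "\<exists>x. F x < m + inverse (real (Suc n))" for n
    using cINF_less_iff[OF _ bdd, of "m + inverse (real (Suc n))"] by (auto simp: m_def)
  then obtain X where X: "\<And>n. F (X n) < m + inverse (real (Suc n))" by metis
  have "Cauchy X"
  proof (rule CauchyI)
    fix e :: real assume "0 < e"
    then have "0 < e\<^sup>2 / 4" by simp
    then obtain N where N: "inverse (real (Suc N)) < e\<^sup>2 / 4" using reals_Archimedean by blast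
    have small: "F (X n) - m < e\<^sup>2 / 4" if "N \<le> n" for n
    proof -
      have "inverse (real (Suc n)) \<le> inverse (real (Suc N))" using that by (simp add: field_simps)
      then show ?thesis using X[of n] N by linarith
    qed
    have "norm (X i - X j) < e" if "N \<le> i" "N \<le> j" for i j
    proof -
      have "(norm (X i - X j))\<^sup>2 < e\<^sup>2"
        using gap[of "X i" "X j"] small[OF that(1)] small[OF that(2)]
        by (simp add: field_simps)
      then show ?thesis using \<open>0 < e\<close> by (simp add: power2_less_imp_less)
    qed
    then show "\<exists>M. \<forall>i\<ge>M. \<forall>j\<ge>M. norm (X i - X j) < e" by blast
  qed
  then obtain v where v: "X \<longlonglongrightarrow> v" using Cauchy_convergent convergentD by blast
  have "(\<lambda>n. F (X n)) \<longlonglongrightarrow> F v"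
    unfolding F_def by (intro tendsto_intros v g.tendsto)
  moreover have "(\<lambda>n. m + inverse (real (Suc n))) \<longlonglongrightarrow> m"
    using LIMSEQ_inverse_real_of_nat_add by blast
  ultimately have "F v \<le> m"
    by (rule LIMSEQ_le) (use X less_imp_le in blast)
  then have min: "F v \<le> F x" for x using m_le[of x] by linarith
  have "g h = h \<bullet> v" for h
  proof (cases "h = 0")
    case False
    define d where "d = h \<bullet> v - g h"
    have expand: "F (v + t *\<^sub>R h) = F v + t\<^sup>2 * (h \<bullet> h) + 2 * t * d" for t
      unfolding F_def d_def
      by (simp add: g.add g.scale algebra_simps inner_commute power2_eq_square)
    have pos: "0 < h \<bullet> h" using False by simp
    \<comment> \<open>This step length minimises the quadratic in \<open>t\<close>; it lowers \<open>F\<close> by \<open>d\<^sup>2 / (h \<bullet> h)\<close>.\<close>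
    have "0 \<le> (- d / (h \<bullet> h))\<^sup>2 * (h \<bullet> h) + 2 * (- d / (h \<bullet> h)) * d"
      using min[of "v + (- d / (h \<bullet> h)) *\<^sub>R h"] expand[of "- d / (h \<bullet> h)"] by linarith
    also have "\<dots> = - (d\<^sup>2 / (h \<bullet> h))" using pos by (simp add: field_simps power2_eq_square)
    finally have "d\<^sup>2 \<le> 0" using pos by (simp add: divide_le_0_iff)
    then show ?thesis by (simp add: d_def)
  qed (simp add: g.zero)
  then show ?thesis by blast
qed

text \<open>The value of the adjoint at \<open>y\<close> has to be the Riesz vector of the functional
  \<open>x \<mapsto> A x \<bullet> y\<close>. Such vectors exist for all \<open>y\<close>, so the choice that defines \<open>adjoint A\<close> is made
  from a nonempty collection of maps.\<close>

lemma adjoint_identity: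
  fixes A :: "'a::{real_inner, complete_space} \<Rightarrow> 'b::real_inner"
  assumes "bounded_linear A"
  shows "x \<bullet> adjoint A y = A x \<bullet> y"
proof -
  have "\<exists>v. \<forall>x. A x \<bullet> y = x \<bullet> v" for y
    by (rule riesz_representation)
      (rule bounded_linear_compose[OF bounded_linear_inner_left assms, unfolded comp_def])
  then have "\<exists>B. \<forall>x y. A x \<bullet> y = x \<bullet> B y" by metis
  then have "\<forall>x y. A x \<bullet> y = x \<bullet> adjoint A y"
    unfolding adjoint_def by (rule someI_ex)
  then show ?thesis by simp
qed

lemma adjoint_zero:
  fixes A :: "'a::{real_inner, complete_space} \<Rightarrow> 'b::real_inner"
  assumes "bounded_linear A"
  shows "adjoint A 0 = 0"
  using adjoint_identity[OF assms, of "adjoint A 0" 0] by simp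

lemma nearest_point_self:
  assumes "x \<in> C"
  shows "nearest_point C x = x"
proof -
  have "is_arg_min (dist x) (\<lambda>y. y \<in> C) x"
    using assms by (simp add: is_arg_min_def not_less)
  then have "is_arg_min (dist x) (\<lambda>y. y \<in> C) (nearest_point C x)"
    unfolding nearest_point_def arg_min_on_def arg_min_def by (rule someI)
  then have "\<not> dist x x < dist x (nearest_point C x)"
    using assms unfolding is_arg_min_def by blast
  then show ?thesis by simp
qed

lemma sfp_solution_fixed_by_operator:
  fixes A :: "'a::{real_inner, complete_space} \<Rightarrow> 'b::real_inner"
  assumes "bounded_linear A" and "z \<in> sfp_solutions C Q A"
  shows "sfp_operator C Q A \<gamma> z = z"
  using assms by (simp add: sfp_solutions_def sfp_operator_def nearest_point_self adjoint_zero)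

text \<open>The fixed point contributes nothing to the right-hand side of the Kannan inequality, and
  \<open>x - T x\<close> is \<open>(k + 1) (x - p)\<close> minus the very vector being estimated, so that vector can be
  absorbed into the left-hand side.\<close>

lemma enriched_kannan_bound_at_fixed_point:
  assumes "enriched_kannan k a T" and "T p = p"
  shows "norm (k *\<^sub>R (x - p) + (T x - p)) \<le> a / (1 - a) * ((k + 1) * norm (x - p))"
proof -
  have k: "0 \<le> k" and a: "0 \<le> a" "a < 1/2"
    using assms by (auto simp: enriched_kannan_def)
  define s where "s = k *\<^sub>R (x - p) + (T x - p)"
  have "norm (k *\<^sub>R (x - p) + T x - T p) \<le> a * (norm (x - T x) + norm (p - T p))"
    using assms(1) unfolding enriched_kannan_def by blast
  then have "norm s \<le> a * norm (x - T x)"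
    by (simp add: s_def assms(2) algebra_simps)
  also have "x - T x = (k + 1) *\<^sub>R (x - p) - s"
    by (simp add: s_def algebra_simps)
  also have "a * norm \<dots> \<le> a * ((k + 1) * norm (x - p) + norm s)"
    using norm_triangle_ineq4[of "(k + 1) *\<^sub>R (x - p)" s] k a(1)
    by (intro mult_left_mono) auto
  finally have "(1 - a) * norm s \<le> a * ((k + 1) * norm (x - p))"
    by (simp add: algebra_simps)
  then show ?thesis
    unfolding s_def[symmetric] using a by (simp add: pos_le_divide_eq mult.commute)
qed

lemma kannan_ratio:
  fixes a :: real
  assumes "0 \<le> a" and "a < 1/2"
  shows "0 \<le> a / (1 - a)" and "a / (1 - a) < 1"
  using assms by (auto simp: divide_simps)

lemma enriched_kannan_unique_fixed_point:
  assumes "enriched_kannan k a T" and "T p = p" and "T q = q"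
  shows "p = q"
proof -
  have "norm (k *\<^sub>R (q - p) + (T q - T p)) \<le> a * (norm (q - T q) + norm (p - T p))"
    using assms(1) unfolding enriched_kannan_def by (metis add_diff_eq)
  moreover have "k *\<^sub>R (q - p) + (q - p) = (k + 1) *\<^sub>R (q - p)"
    by (simp add: algebra_simps)
  ultimately have "norm ((k + 1) *\<^sub>R (q - p)) \<le> 0"
    using assms(2,3) by simp
  then have "(k + 1) *\<^sub>R (q - p) = 0" by (simp only: norm_le_zero_iff)
  moreover have "k + 1 \<noteq> 0" using assms(1) by (simp add: enriched_kannan_def)
  ultimately show ?thesis by simp
qed

text \<open>With weight \<open>1 / (k + 2)\<close> the displacement of the averaged point from \<open>p\<close> is
  \<open>(x - p) + (k (x - p) + (T x - p))\<close> divided by \<open>k + 2\<close>; the two summands have norm at most 1 and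
  \<open>(k + 1) c\<close> times \<open>\<parallel>x - p\<parallel>\<close>, where \<open>c = a / (1 - a)\<close>.\<close>

lemma enriched_kannan_averaged_contracts:
  assumes "enriched_kannan k a T" and "T p = p"
  defines "\<mu> \<equiv> 1 / (k + 2)"
  shows "norm ((1 - \<mu>) *\<^sub>R x + \<mu> *\<^sub>R T x - p)
    \<le> (1 + (k + 1) * (a / (1 - a))) / (k + 2) * norm (x - p)"
proof -
  have k: "0 \<le> k" using assms(1) by (simp add: enriched_kannan_def)
  let ?s = "k *\<^sub>R (x - p) + (T x - p)"
  have "\<mu> * (k + 2) = 1" using k by (simp add: \<mu>_def)
  then have "1 - \<mu> = \<mu> * (k + 1)" by (simp add: algebra_simps)
  moreover have "(1 - \<mu>) *\<^sub>R x + \<mu> *\<^sub>R T x - p = (1 - \<mu>) *\<^sub>R (x - p) + \<mu> *\<^sub>R (T x - p)"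
    by (simp add: algebra_simps)
  moreover have "(\<mu> * (k + 1)) *\<^sub>R (x - p) + \<mu> *\<^sub>R (T x - p) = \<mu> *\<^sub>R ((x - p) + ?s)"
    by (simp add: algebra_simps)
  ultimately have "norm ((1 - \<mu>) *\<^sub>R x + \<mu> *\<^sub>R T x - p) = norm ((x - p) + ?s) / (k + 2)"
    using k by (simp add: \<mu>_def)
  also have "\<dots> \<le> (norm (x - p) + a / (1 - a) * ((k + 1) * norm (x - p))) / (k + 2)"
    using norm_triangle_ineq[of "x - p" ?s]
      enriched_kannan_bound_at_fixed_point[OF assms(1,2), of x] k
    by (intro divide_right_mono) auto
  also have "\<dots> = (1 + (k + 1) * (a / (1 - a))) / (k + 2) * norm (x - p)"
  proof -
    have "n + c * ((k + 1) * n) = (1 + (k + 1) * c) * n" for c n :: real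
      by (simp add: algebra_simps)
    from this[of "norm (x - p)" "a / (1 - a)"] show ?thesis by simp
  qed
  finally show ?thesis .
qed

lemma LIMSEQ_of_geometric_decay:
  fixes x :: "nat \<Rightarrow> 'a::real_normed_vector"
  assumes "0 \<le> r" and "r < 1" and step: "\<And>n. norm (x (Suc n) - p) \<le> r * norm (x n - p)"
  shows "x \<longlonglongrightarrow> p"
proof -
  have bound: "norm (x n - p) \<le> r ^ n * norm (x 0 - p)" for n
  proof (induction n)
    case (Suc n)
    have "r * norm (x n - p) \<le> r * (r ^ n * norm (x 0 - p))"
      using Suc assms(1) by (rule mult_left_mono)
    then show ?case using step[of n] by (simp add: mult.assoc)
  qed simp
  have "(\<lambda>n. r ^ n * norm (x 0 - p)) \<longlonglongrightarrow> 0"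
    using assms(1,2) by (intro tendsto_mult_left_zero LIMSEQ_realpow_zero)
  then have "(\<lambda>n. x n - p) \<longlonglongrightarrow> 0"
    by (rule tendsto_0_le[where K = 1])
      (use bound in \<open>auto intro!: always_eventually order_trans[OF _ abs_ge_self]\<close>)
  then show ?thesis by (simp add: LIM_zero_iff)
qed

theorem theorem4:
  fixes C :: "'a::{real_inner, complete_space} set"
    and Q :: "'b::{real_inner, complete_space} set"
    and A :: "'a \<Rightarrow> 'b"
    and \<gamma> k a :: real
  assumes "closed C" and "convex C"
    and "closed Q" and "convex Q"
    and "bounded_linear A"
    and "sfp_solutions C Q A \<noteq> {}"
    and "0 < \<gamma>" and "ennreal \<gamma> < 2 / spectral_radius (adjoint A \<circ> A)"
    and "enriched_kannan k a (sfp_operator C Q A \<gamma>)"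
  shows "\<exists>x'. sfp_solutions C Q A = {x'} \<and>
    (\<exists>\<mu>::real. 0 \<le> \<mu> \<and> \<mu> < 1 \<and>
      (\<forall>x0\<in>C. \<forall>x :: nat \<Rightarrow> 'a.
        x 0 = x0 \<and>
        (\<forall>n. x (Suc n) = (1 - \<mu>) *\<^sub>R x n + \<mu> *\<^sub>R sfp_operator C Q A \<gamma> (x n)) \<longrightarrow>
        x \<longlonglongrightarrow> x'))"
proof -
  let ?T = "sfp_operator C Q A \<gamma>"
  note kannan = assms(9)
  have fixed: "?T z = z" if "z \<in> sfp_solutions C Q A" for z
    using sfp_solution_fixed_by_operator[OF assms(5) that] .
  obtain p where p: "p \<in> sfp_solutions C Q A" using assms(6) by blast
  have unique: "sfp_solutions C Q A = {p}"
    using p fixed enriched_kannan_unique_fixed_point[OF kannan] by blast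
  define \<mu> where "\<mu> = 1 / (k + 2)"
  define r where "r = (1 + (k + 1) * (a / (1 - a))) / (k + 2)"
  have k: "0 \<le> k" and a: "0 \<le> a" "a < 1/2"
    using kannan by (auto simp: enriched_kannan_def)
  have \<mu>: "0 \<le> \<mu>" "\<mu> < 1" using k by (auto simp: \<mu>_def)
  have "0 \<le> (k + 1) * (a / (1 - a))"
    using k kannan_ratio(1)[OF a] by (intro mult_nonneg_nonneg) auto
  then have r0: "0 \<le> r" using k unfolding r_def by (intro divide_nonneg_nonneg) auto
  have "(k + 1) * (a / (1 - a)) < (k + 1) * 1"
    using k kannan_ratio(2)[OF a] by (intro mult_strict_left_mono) auto
  then have r1: "r < 1" unfolding r_def using k by (subst pos_divide_less_eq) auto
  have "x \<longlonglongrightarrow> p" if "\<forall>n. x (Suc n) = (1 - \<mu>) *\<^sub>R x n + \<mu> *\<^sub>R ?T (x n)" for x :: "nat \<Rightarrow> 'a"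
  proof (rule LIMSEQ_of_geometric_decay[OF r0 r1])
    show "norm (x (Suc n) - p) \<le> r * norm (x n - p)" for n
      using enriched_kannan_averaged_contracts[OF kannan fixed[OF p], of "x n"] that
      by (simp add: \<mu>_def r_def)
  qed
  then show ?thesis using unique \<mu> by blast
qed

end
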